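(* Let $(\Omega,\mathbf{P})$ be a probability trial. Then: (a) Exact p-values are values of an exact p-function: for every test order $\le$ on $\Omega$ there is an exact p-function $f$ such that, for every outcome $x\in\Omega$, the exact p-value $\mathbf{P}[\le x]$ of $x$ with respect to $\le$ equals $f(x)$; likewise, for every test statistic $g$ on $\Omega$ there is an exact p-function $f$ such that, for every $x\in\Omega$, the exact p-value $\mathbf{P}[g\le g(x)]$ of $x$ with respect to $g$ equals $f(x)$. (b) Every test order on $\Omega$ induces a unique exact p-function. (c) Every test statistic on $\Omega$ is equivalent to a unique exact p-function.
   Context: A probability trial $(\Omega,\mathbf{P})$ consists of a nonempty countable (finite or countably infinite) set $\Omega$ and a function $\mathbf{P}:\Omega\to[0,1]$ with $\mathbf{P}(x)>0$ for every $x\in\Omega$ and $\sum_{x\in\Omega}\mathbf{P}(x)=1$. Elements of $\Omega$ are outcomes, subsets are events, and for $E\subseteq\Omega$ one puts $\mathbf{P}(E)=\sum_{x\in E}\mathbf{P}(x)$. A test order on $\Omega$ is a linear preorder $\le$ on $\Omega$ (reflexive, transitive, and for all $x,y$: $x\le y$ or $y\le x$; distinct $x,y$ with $x\le y$ and $y\le x$ are allowed). For a test order, $[\le x]=\{y\in\Omega: y\le x\}$ and $\mathbf{P}[\le x]$ is its probability. A test statistic on $\Omega$ is a function $f:\Omega\to\mathbb{R}$. For real $r$, $[f\le r]=\{x\in\Omega: f(x)\le r\}$ and $\mathbf{P}[f\le r]$ is its probability. A test order $\le$ induces the test statistic $f(x)=\mathbf{P}[\le x]$. A test statistic $f$ induces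 the test order $\{(x,y): f(x)\le f(y)\}$. Two test statistics are equivalent if they induce the same test order. The exact p-value of an outcome $x$ with respect to a test order $\le$ is $\mathbf{P}[\le x]$; with respect to a test statistic $f$ it is $\mathbf{P}[f\le f(x)]$. A p-function is a test statistic $f$ such that $\mathbf{P}[f\le\varepsilon]\le\varepsilon$ for every real $\varepsilon\ge 0$. A p-function $f$ is exact if $\mathbf{P}[f\le\varepsilon]=\varepsilon$ for every $\varepsilon$ in the range of $f$. *)

theory Defs
  imports "HOL-Analysis.Infinite_Sum" "HOL-Library.FuncSet" "HOL-Library.Countable_Set"
begin

definition prob_trial :: "'a set \<Rightarrow> ('a \<Rightarrow> real) \<Rightarrow> bool" where
  "prob_trial \<Omega> P \<longleftrightarrow>
     \<Omega> \<noteq> {} \<and> countable \<Omega> \<and> P \<in> \<Omega> \<rightarrow> {0..1} \<and> (\<forall>x\<in>\<Omega>. 0 < P x) \<and> (P has_sum 1) \<Omega>"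

definition prob :: "('a \<Rightarrow> real) \<Rightarrow> 'a set \<Rightarrow> real" where
  "prob P E = infsum P E"

(* A pair (x, y) in r stands for "x <= y".  Since total_on only speaks about distinct elements,
   it gives linearity together with the reflexivity contained in preorder_on;
   antisymmetry is deliberately not required. *)
definition test_order :: "'a set \<Rightarrow> 'a rel \<Rightarrow> bool" where
  "test_order \<Omega> r \<longleftrightarrow> preorder_on \<Omega> r \<and> total_on \<Omega> r"

(* Functions with domain \<Omega> are represented by total functions that are undefined outside \<Omega>,
   so that HOL equality is equality of functions on \<Omega>; uniqueness claims rely on this. *)
definition test_statistic :: "'a set \<Rightarrow> ('a \<Rightarrow> real) \<Rightarrow> bool" where
  "test_statistic \<Omega> f \<longleftrightarrow> f \<in> \<Omega> \<rightarrow>\<^sub>E UNIV"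

definition order_event :: "'a set \<Rightarrow> 'a rel \<Rightarrow> 'a \<Rightarrow> 'a set" where
  "order_event \<Omega> r x = {y \<in> \<Omega>. (y, x) \<in> r}"

definition stat_event :: "'a set \<Rightarrow> ('a \<Rightarrow> real) \<Rightarrow> real \<Rightarrow> 'a set" where
  "stat_event \<Omega> f t = {x \<in> \<Omega>. f x \<le> t}"

definition induced_statistic :: "'a set \<Rightarrow> ('a \<Rightarrow> real) \<Rightarrow> 'a rel \<Rightarrow> 'a \<Rightarrow> real" where
  "induced_statistic \<Omega> P r = (\<lambda>x\<in>\<Omega>. prob P (order_event \<Omega> r x))"

definition induced_order :: "'a set \<Rightarrow> ('a \<Rightarrow> real) \<Rightarrow> 'a rel" where
  "induced_order \<Omega> f = {(x, y). x \<in> \<Omega> \<and> y \<in> \<Omega> \<and> f x \<le> f y}"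

definition equivalent_statistics :: "'a set \<Rightarrow> ('a \<Rightarrow> real) \<Rightarrow> ('a \<Rightarrow> real) \<Rightarrow> bool" where
  "equivalent_statistics \<Omega> f g \<longleftrightarrow> induced_order \<Omega> f = induced_order \<Omega> g"

definition order_p_value :: "'a set \<Rightarrow> ('a \<Rightarrow> real) \<Rightarrow> 'a rel \<Rightarrow> 'a \<Rightarrow> real" where
  "order_p_value \<Omega> P r x = prob P (order_event \<Omega> r x)"

definition stat_p_value :: "'a set \<Rightarrow> ('a \<Rightarrow> real) \<Rightarrow> ('a \<Rightarrow> real) \<Rightarrow> 'a \<Rightarrow> real" where
  "stat_p_value \<Omega> P f x = prob P (stat_event \<Omega> f (f x))"

definition p_function :: "'a set \<Rightarrow> ('a \<Rightarrow> real) \<Rightarrow> ('a \<Rightarrow> real) \<Rightarrow> bool" where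
  "p_function \<Omega> P f \<longleftrightarrow>
     test_statistic \<Omega> f \<and> (\<forall>\<epsilon>\<ge>0. prob P (stat_event \<Omega> f \<epsilon>) \<le> \<epsilon>)"

definition exact_p_function :: "'a set \<Rightarrow> ('a \<Rightarrow> real) \<Rightarrow> ('a \<Rightarrow> real) \<Rightarrow> bool" where
  "exact_p_function \<Omega> P f \<longleftrightarrow>
     p_function \<Omega> P f \<and> (\<forall>\<epsilon>\<in>f ` \<Omega>. prob P (stat_event \<Omega> f \<epsilon>) = \<epsilon>)"

end

theory Submission
  imports Defs
begin

text \<open>
  A test order and its induced statistic \<open>x \<mapsto> P[\<le> x]\<close> determine each other.  Enlarging an outcome
  enlarges its initial segment, and strictly so when the outcomes are not tied, because the bigger
  segment then contains an outcome of positive weight outside the smaller one; so the statistic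
  induces the order again (\<open>induced_order_induced_statistic\<close>).  Consequently the event of values
  at most \<open>P[\<le> x]\<close> is the segment \<open>[\<le> x]\<close> itself, which is exactness.

  The point that needs care is that the statistic is a p-function at a level \<open>\<epsilon>\<close> outside its range:
  the outcomes with \<open>P[\<le> x] \<le> \<epsilon>\<close> form an initial segment that may have no largest element, so its
  probability need not be a p-value.  But every finite part of it has a largest element and
  is therefore contained in a segment \<open>[\<le> x]\<close> of probability at most \<open>\<epsilon>\<close>, and the probability
  of the whole event is the supremum over its finite parts (\<open>p_function_induced_statistic\<close>).

  Conversely an exact p-function satisfies \<open>f x = P[f \<le> f x]\<close>, and the right-hand side depends
  on \<open>f\<close> only through the induced order; this gives uniqueness
  (\<open>exact_p_function_eq_induced_statistic\<close>).  The claims about a test statistic are those about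
  the test order that it induces.
\<close>

lemma prob_trial_nonneg: "prob_trial \<Omega> P \<Longrightarrow> x \<in> \<Omega> \<Longrightarrow> 0 \<le> P x"
  by (auto simp: prob_trial_def intro: less_imp_le)

lemma prob_trial_summable:
  assumes "prob_trial \<Omega> P" "E \<subseteq> \<Omega>"
  shows "P summable_on E"
proof (rule summable_on_subset_banach[OF _ assms(2)])
  show "P summable_on \<Omega>"
    using assms(1) by (auto simp: prob_trial_def intro: has_sum_imp_summable)
qed

lemma prob_mono:
  assumes "prob_trial \<Omega> P" "D \<subseteq> E" "E \<subseteq> \<Omega>"
  shows "prob P D \<le> prob P E"
  unfolding prob_def
  using assms by (intro infsum_mono2) (auto intro: prob_trial_summable[OF assms(1)] prob_trial_nonneg[OF assms(1)])

lemma sum_le_prob: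
  assumes "prob_trial \<Omega> P" "finite F" "F \<subseteq> E" "E \<subseteq> \<Omega>"
  shows "sum P F \<le> prob P E"
  unfolding prob_def
  using assms by (intro finite_sum_le_infsum) (auto intro: prob_trial_summable[OF assms(1)] prob_trial_nonneg[OF assms(1)])

lemma prob_strict_mono:
  assumes "prob_trial \<Omega> P" "D \<subset> E" "E \<subseteq> \<Omega>"
  shows "prob P D < prob P E"
proof -
  obtain y where y: "y \<in> E" "y \<notin> D" using assms(2) by blast
  have "prob P (insert y D) = P y + prob P D"
    unfolding prob_def using assms(2,3) y(2)
    by (intro infsum_insert prob_trial_summable[OF assms(1)]) auto
  moreover have "prob P (insert y D) \<le> prob P E"
    using assms y by (intro prob_mono[OF assms(1)]) auto
  moreover have "0 < P y" using assms y by (auto simp: prob_trial_def)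
  ultimately show ?thesis by linarith
qed

lemma prob_le_finite_sums:
  assumes "prob_trial \<Omega> P" "E \<subseteq> \<Omega>" "\<And>F. finite F \<Longrightarrow> F \<subseteq> E \<Longrightarrow> sum P F \<le> b"
  shows "prob P E \<le> b"
  unfolding prob_def using assms by (intro infsum_le_finite_sums) (auto intro: prob_trial_summable[OF assms(1)])

lemma test_orderD:
  assumes "test_order \<Omega> r"
  shows "r \<subseteq> \<Omega> \<times> \<Omega>" "refl_on \<Omega> r" "trans r" "total_on \<Omega> r"
  using assms by (auto simp: test_order_def preorder_on_def)

lemma test_order_linear:
  assumes "test_order \<Omega> r" "x \<in> \<Omega>" "y \<in> \<Omega>"
  shows "(x, y) \<in> r \<or> (y, x) \<in> r"
  using assms test_orderD(2,4)[OF assms(1)] by (metis refl_onD total_on_def)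

lemma test_order_induced_order: "test_order \<Omega> (induced_order \<Omega> f)"
  by (auto simp: test_order_def preorder_on_def induced_order_def total_on_def
      intro!: refl_onI transI)

lemma order_event_induced_order:
  "x \<in> \<Omega> \<Longrightarrow> order_event \<Omega> (induced_order \<Omega> f) x = stat_event \<Omega> f (f x)"
  by (auto simp: order_event_def stat_event_def induced_order_def)

lemma stat_p_value_eq_order_p_value:
  "x \<in> \<Omega> \<Longrightarrow> stat_p_value \<Omega> P f x = order_p_value \<Omega> P (induced_order \<Omega> f) x"
  by (simp add: stat_p_value_def order_p_value_def order_event_induced_order)

lemma order_p_value_eq_induced_statistic:
  "x \<in> \<Omega> \<Longrightarrow> order_p_value \<Omega> P r x = induced_statistic \<Omega> P r x"
  by (simp add: induced_statistic_def order_p_value_def)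

lemma finite_test_order_has_max:
  assumes "test_order \<Omega> r" "finite F" "F \<noteq> {}" "F \<subseteq> \<Omega>"
  shows "\<exists>m\<in>F. \<forall>y\<in>F. (y, m) \<in> r"
  using assms(2-4)
proof (induction F rule: finite_ne_induct)
  case (singleton x)
  then show ?case using test_order_linear[OF assms(1)] by blast
next
  case (insert x F)
  then obtain m where m: "m \<in> F" "\<forall>y\<in>F. (y, m) \<in> r" by auto
  have "(x, m) \<in> r \<or> (m, x) \<in> r" "(x, x) \<in> r"
    using test_order_linear[OF assms(1)] insert.prems m(1) by blast+
  then show ?case using m transD[OF test_orderD(3)[OF assms(1)]] by blast
qed

text \<open>
  Positivity of every single weight is what keeps outcomes that are strictly ordered from
  receiving the same p-value.
\<close>
lemma induced_order_induced_statistic: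
  assumes "prob_trial \<Omega> P" "test_order \<Omega> r"
  shows "induced_order \<Omega> (induced_statistic \<Omega> P r) = r"
proof -
  have "prob P (order_event \<Omega> r x) \<le> prob P (order_event \<Omega> r y) \<longleftrightarrow> (x, y) \<in> r"
    if x: "x \<in> \<Omega>" and y: "y \<in> \<Omega>" for x y
  proof
    assume "(x, y) \<in> r"
    then have "order_event \<Omega> r x \<subseteq> order_event \<Omega> r y"
      using test_orderD(3)[OF assms(2)] by (auto simp: order_event_def dest: transD)
    then show "prob P (order_event \<Omega> r x) \<le> prob P (order_event \<Omega> r y)"
      by (intro prob_mono[OF assms(1)]) (auto simp: order_event_def)
  next
    assume le: "prob P (order_event \<Omega> r x) \<le> prob P (order_event \<Omega> r y)"
    show "(x, y) \<in> r"
    proof (rule ccontr)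
      assume n: "(x, y) \<notin> r"
      then have "(y, x) \<in> r" "(x, x) \<in> r" using test_order_linear[OF assms(2)] x y by blast+
      then have "order_event \<Omega> r y \<subset> order_event \<Omega> r x"
        using n x test_orderD(3)[OF assms(2)] by (auto simp: order_event_def dest: transD)
      then have "prob P (order_event \<Omega> r y) < prob P (order_event \<Omega> r x)"
        by (intro prob_strict_mono[OF assms(1)]) (auto simp: order_event_def)
      with le show False by simp
    qed
  qed
  then show ?thesis
    using test_orderD(1)[OF assms(2)] by (auto simp: induced_order_def induced_statistic_def)
qed

text \<open>
  The bound at an arbitrary level is a limit of bounds at p-values: the event \<open>[f \<le> \<epsilon>]\<close> is exhausted
  by finite sets, and the largest element of such a set has a p-value at most \<open>\<epsilon>\<close> that
  already pays for the whole set.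
\<close>
lemma p_function_induced_statistic:
  assumes "prob_trial \<Omega> P" "test_order \<Omega> r"
  shows "p_function \<Omega> P (induced_statistic \<Omega> P r)"
proof -
  let ?f = "induced_statistic \<Omega> P r"
  have "prob P (stat_event \<Omega> ?f \<epsilon>) \<le> \<epsilon>" if "0 \<le> \<epsilon>" for \<epsilon>
  proof (rule prob_le_finite_sums[OF assms(1)])
    show "stat_event \<Omega> ?f \<epsilon> \<subseteq> \<Omega>" by (auto simp: stat_event_def)
  next
    fix F assume F: "finite F" "F \<subseteq> stat_event \<Omega> ?f \<epsilon>"
    show "sum P F \<le> \<epsilon>"
    proof (cases "F = {}")
      case False
      have F\<Omega>: "F \<subseteq> \<Omega>" using F by (auto simp: stat_event_def)
      obtain m where m: "m \<in> F" "\<forall>y\<in>F. (y, m) \<in> r"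
        using finite_test_order_has_max[OF assms(2) F(1) False F\<Omega>] by blast
      have "sum P F \<le> prob P (order_event \<Omega> r m)"
        using F\<Omega> m by (intro sum_le_prob[OF assms(1) F(1)]) (auto simp: order_event_def)
      also have "\<dots> \<le> \<epsilon>"
        using F(2) m(1) by (auto simp: stat_event_def induced_statistic_def)
      finally show ?thesis .
    qed (use that in simp)
  qed
  then show ?thesis by (auto simp: p_function_def test_statistic_def induced_statistic_def)
qed

text \<open>
  Since the statistic induces \<open>r\<close> again, its level set at the value of \<open>x\<close> is the initial segment
  of \<open>x\<close>, whose probability is that value by construction.
\<close>
lemma exact_p_function_induced_statistic:
  assumes "prob_trial \<Omega> P" "test_order \<Omega> r"
  shows "exact_p_function \<Omega> P (induced_statistic \<Omega> P r)"
proof -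
  let ?f = "induced_statistic \<Omega> P r"
  have "prob P (stat_event \<Omega> ?f (?f x)) = ?f x" if x: "x \<in> \<Omega>" for x
  proof -
    have "stat_event \<Omega> ?f (?f x) = order_event \<Omega> r x"
      using order_event_induced_order[OF x, of ?f] induced_order_induced_statistic[OF assms]
      by simp
    then show ?thesis using x by (simp add: induced_statistic_def)
  qed
  then show ?thesis
    using p_function_induced_statistic[OF assms] by (auto simp: exact_p_function_def)
qed

text \<open>
  Exactness at the value \<open>f x\<close> is a formula for \<open>f x\<close> in terms of the event \<open>[f \<le> f x]\<close>, that is,
  of the order alone.  Hence exact p-functions with the same induced order coincide.
\<close>
lemma exact_p_function_eq_induced_statistic:
  assumes "exact_p_function \<Omega> P f"
  shows "f = induced_statistic \<Omega> P (induced_order \<Omega> f)"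
proof (rule extensionalityI)
  show "f \<in> extensional \<Omega>"
    using assms by (auto simp: exact_p_function_def p_function_def test_statistic_def PiE_def)
  show "induced_statistic \<Omega> P (induced_order \<Omega> f) \<in> extensional \<Omega>"
    by (simp add: induced_statistic_def)
  fix x assume "x \<in> \<Omega>"
  then show "f x = induced_statistic \<Omega> P (induced_order \<Omega> f) x"
    using assms by (simp add: exact_p_function_def induced_statistic_def order_event_induced_order)
qed

lemma ex1_exact_p_function:
  assumes "prob_trial \<Omega> P" "test_order \<Omega> r"
  shows "\<exists>!f. exact_p_function \<Omega> P f \<and> induced_order \<Omega> f = r"
proof (rule ex1I)
  show "exact_p_function \<Omega> P (induced_statistic \<Omega> P r) \<and>
      induced_order \<Omega> (induced_statistic \<Omega> P r) = r"
    using exact_p_function_induced_statistic induced_order_induced_statistic assms by blast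
next
  fix f assume "exact_p_function \<Omega> P f \<and> induced_order \<Omega> f = r"
  then show "f = induced_statistic \<Omega> P r"
    using exact_p_function_eq_induced_statistic[of \<Omega> P f] by simp
qed

theorem corollary20:
  fixes \<Omega> :: "'a set" and P :: "'a \<Rightarrow> real"
  assumes "prob_trial \<Omega> P"
  shows
    "((\<forall>r. test_order \<Omega> r \<longrightarrow>
         (\<exists>f. exact_p_function \<Omega> P f \<and> (\<forall>x\<in>\<Omega>. order_p_value \<Omega> P r x = f x))) \<and>
      (\<forall>g. test_statistic \<Omega> g \<longrightarrow>
         (\<exists>f. exact_p_function \<Omega> P f \<and> (\<forall>x\<in>\<Omega>. stat_p_value \<Omega> P g x = f x)))) \<and>
     (\<forall>r. test_order \<Omega> r \<longrightarrow>
         exact_p_function \<Omega> P (induced_statistic \<Omega> P r) \<and>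
         induced_order \<Omega> (induced_statistic \<Omega> P r) = r \<and>
         (\<exists>!f. exact_p_function \<Omega> P f \<and> induced_order \<Omega> f = r)) \<and>
     (\<forall>g. test_statistic \<Omega> g \<longrightarrow>
         (\<exists>!f. exact_p_function \<Omega> P f \<and> equivalent_statistics \<Omega> g f))"
proof -
  note exact = exact_p_function_induced_statistic[OF assms]
  have order_p: "\<exists>f. exact_p_function \<Omega> P f \<and> (\<forall>x\<in>\<Omega>. order_p_value \<Omega> P r x = f x)"
    if "test_order \<Omega> r" for r
    using exact[OF that] by (auto simp: order_p_value_eq_induced_statistic)
  have stat_p: "\<exists>f. exact_p_function \<Omega> P f \<and> (\<forall>x\<in>\<Omega>. stat_p_value \<Omega> P g x = f x)" for g
    using order_p[OF test_order_induced_order, of g]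
    by (simp add: stat_p_value_eq_order_p_value cong: ball_cong)
  have equiv: "\<exists>!f. exact_p_function \<Omega> P f \<and> equivalent_statistics \<Omega> g f" for g
    using ex1_exact_p_function[OF assms test_order_induced_order, of g]
    unfolding equivalent_statistics_def by (simp only: eq_commute[of "induced_order \<Omega> g"])
  show ?thesis
    by (intro conjI allI impI; intro order_p stat_p equiv exact
        induced_order_induced_statistic[OF assms] ex1_exact_p_function[OF assms])
qed

end
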